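(* Consider the source model in which all source symbols have the same length $L$ and the edit probability is $\delta<\frac14$, in the asymptotic regime described in the context. For any $\beta$ with $\delta<\beta\le\frac14$, the performance of edit-distance deduplication (EDD) with chunk length $\ell=L$ and mismatch ratio $\beta$ satisfies $$1\le\frac{\mathbb{E}[\mathcal{L}_{ED}(\boldsymbol{s})]}{H(\boldsymbol{s})}\le\frac{H(2\beta)}{H(\delta)}(1+o(1)),\qquad\text{as }B\to\infty.$$
   Context: All logarithms are base 2. $H(p)=p\log\frac1p+(1-p)\log\frac1{1-p}$ is the binary entropy. Source model (equal symbol lengths). Parameters: positive integers $A,B,L$ and an edit probability $\delta$. Source symbols $X_1,\dots,X_A$ are drawn independently and uniformly from $\{0,1\}^L$ (with replacement). Then, independently for $b=1,\dots,B$, an index $J_b$ is drawn uniformly from $\{1,\dots,A\}$ and the source block $Y_b$ is obtained from $X_{J_b}$ by a $\delta$-edit, i.e. by flipping each bit independently with probability $\delta$. The data stream is $\boldsymbol{s}=Y_1Y_2\cdots Y_B$; $H(\boldsymbol{s})$ is its Shannon entropy in bits. Asymptotic regime. $B\to\infty$; $A$ and $L$ are functions of $B$ tending to infinity with $A\le B^{1-k_2}$ for a fixed $0<k_2<1$ and $L=\Theta(B^{k_1})$ for a fixed $k_1>0$; $\delta>0$ is constant. Edit-distance deduplication (EDD) with chunk length $\ell$ and mismatch ratio $\beta$, $\delta<\beta\le\frac14$. The string $\boldsymbol{s}$ is parsed into consecutive chunks $\boldsymbol{z}_1,\boldsymbol{z}_2,\dots$ of length $\ell$ (the last possibly shorter).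 The encoding starts with a prefix-free (Elias gamma) encoding of $|\boldsymbol{s}|$ (at most $2\log|\boldsymbol{s}|+3$ bits). Chunks are processed in order, starting with an empty dictionary. If no chunk in the dictionary is within Hamming distance $2\beta\ell$ of $\boldsymbol{z}_c$, then $\boldsymbol{z}_c$ is encoded as the bit 1 followed by $\boldsymbol{z}_c$ itself and is entered into the dictionary. Otherwise, let $c'$ be the smallest index such that $\boldsymbol{z}_{c'}$ is stored in the dictionary and is within Hamming distance $2\beta\ell$ of $\boldsymbol{z}_c$; $\boldsymbol{z}_c$ is encoded as the bit 0, followed by a pointer to the dictionary entry storing $\boldsymbol{z}_{c'}$ ($\lceil\log t\rceil$ bits when the current dictionary has size $t$, so at most $\log t+1$), followed by a description of the set of positions in which $\boldsymbol{z}_c$ and $\boldsymbol{z}_{c'}$ differ, which takes at most $\log\left(\sum_{i=0}^{\lfloor2\beta\ell\rfloor}\binom{\ell}{i}\right)+1\le H(2\beta)\ell+1$ bits. The encoding is prefix-free (uniquely decodable). $\mathcal{L}_{ED}(\boldsymbol{s})$ is the number of bits EDD uses to encode $\boldsymbol{s}$. *)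

theory Defs
  imports
    "HOL-Probability.Probability"
    "HOL-Library.Landau_Symbols"
    "HOL-Library.Nat_Bijection"
begin

section \<open>Entropy, in bits\<close>

definition binary_entropy :: "real \<Rightarrow> real" where
  "binary_entropy p = p * log 2 (1 / p) + (1 - p) * log 2 (1 / (1 - p))"

definition shannon_entropy :: "'a pmf \<Rightarrow> real" where
  "shannon_entropy p = prob_space.entropy (measure_pmf p) 2 (count_space UNIV) (\<lambda>x. x)"

lemma shannon_entropy_eq_sum:
  fixes p :: "'a :: countable pmf"
  assumes fin: "finite (set_pmf p)"
  shows "shannon_entropy p = - (\<Sum>x\<in>set_pmf p. pmf p x * log 2 (pmf p x))"
proof -
  interpret information_space "measure_pmf p" 2
    by unfold_locales simp
  have "distr (measure_pmf p) (count_space UNIV) (\<lambda>x. x) = measure_pmf p"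
    using distr_cong[of "measure_pmf p" "measure_pmf p" "count_space UNIV" "measure_pmf p" "\<lambda>x. x" "\<lambda>x. x"]
    by (simp add: distr_id)
  then have "distributed (measure_pmf p) (count_space UNIV) (\<lambda>x. x) (\<lambda>x. ennreal (pmf p x))"
    unfolding distributed_def by (simp flip: measure_pmf_eq_density)
  then have "shannon_entropy p = - (\<integral>x. pmf p x * log 2 (pmf p x) \<partial>count_space UNIV)"
    unfolding shannon_entropy_def
    by (intro entropy_distr)
       (auto intro: sigma_finite_measure_count_space)
  also have "(\<integral>x. pmf p x * log 2 (pmf p x) \<partial>count_space UNIV)
      = (\<Sum>x\<in>set_pmf p. pmf p x * log 2 (pmf p x))"
  proof -
    have "{x. pmf p x * log 2 (pmf p x) \<noteq> 0} \<subseteq> set_pmf p"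
      by (auto simp: set_pmf_iff)
    then show ?thesis
      using fin
      by (subst lebesgue_integral_count_space_finite_support)
         (auto intro: finite_subset intro!: sum.mono_neutral_left)
  qed
  finally show ?thesis .
qed


section \<open>The source\<close>

definition edit_pmf :: "real \<Rightarrow> bool list \<Rightarrow> bool list pmf" where
  "edit_pmf \<delta> x =
     map_pmf (\<lambda>flips. map2 (\<noteq>) x flips) (replicate_pmf (length x) (bernoulli_pmf \<delta>))"

text \<open>The source symbols are indexed from 0 here.\<close>

definition source_pmf :: "nat \<Rightarrow> nat \<Rightarrow> nat \<Rightarrow> real \<Rightarrow> bool list pmf" where
  "source_pmf A B L \<delta> = do {
     X \<leftarrow> replicate_pmf A (pmf_of_set {x. length x = L});
     Y \<leftarrow> replicate_pmf B (do { j \<leftarrow> pmf_of_set {..<A}; edit_pmf \<delta> (X ! j) });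
     return_pmf (concat Y)
   }"


section \<open>Edit-distance deduplication\<close>

text \<open>The \<open>w\<close>-bit binary expansion of \<open>n\<close>, most significant bit first.\<close>

definition to_bits :: "nat \<Rightarrow> nat \<Rightarrow> bool list" where
  "to_bits w n = map (\<lambda>i. odd (n div 2 ^ i)) (rev [0..<w])"

text \<open>The least width of a fixed-length code for \<open>n \<ge> 1\<close> objects.\<close>

definition index_width :: "nat \<Rightarrow> nat" where
  "index_width n = nat \<lceil>log 2 (real n)\<rceil>"

text \<open>Meaningful for \<open>n \<ge> 1\<close> only.\<close>

definition elias_gamma :: "nat \<Rightarrow> bool list" where
  "elias_gamma n = (let k = nat \<lfloor>log 2 (real n)\<rfloor> in replicate k False @ to_bits (Suc k) n)"

fun chunks :: "nat \<Rightarrow> 'a list \<Rightarrow> 'a list list" where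
  "chunks l s = (if s = [] \<or> l = 0 then [] else take l s # chunks l (drop l s))"

declare chunks.simps [simp del]

definition diff_set :: "'a list \<Rightarrow> 'a list \<Rightarrow> nat set" where
  "diff_set x y = {i. i < length x \<and> x ! i \<noteq> y ! i}"

text \<open>Hamming distance is defined between strings of equal length only, so a final chunk that is
  shorter than the others is never close to a dictionary entry.\<close>

definition close :: "real \<Rightarrow> nat \<Rightarrow> 'a list \<Rightarrow> 'a list \<Rightarrow> bool" where
  "close \<beta> l x y \<longleftrightarrow> length x = length y \<and> real (card (diff_set x y)) \<le> 2 * \<beta> * real l"

text \<open>The possible difference sets are numbered in the order of \<^const>\<open>set_encode\<close>, and a
  difference set is described by its number, written with a fixed number of bits.\<close>

definition diff_patterns :: "real \<Rightarrow> nat \<Rightarrow> nat set set" where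
  "diff_patterns \<beta> l = {S. S \<subseteq> {..<l} \<and> card S \<le> nat \<lfloor>2 * \<beta> * real l\<rfloor>}"

definition diff_code :: "real \<Rightarrow> nat \<Rightarrow> nat set \<Rightarrow> bool list" where
  "diff_code \<beta> l S =
     to_bits (index_width (\<Sum>i\<le>nat \<lfloor>2 * \<beta> * real l\<rfloor>. l choose i))
       (card {T \<in> diff_patterns \<beta> l. set_encode T < set_encode S})"

text \<open>The dictionary \<open>D\<close> lists the stored chunks in the order of their insertion, so the
  smallest index of a close stored chunk is the first such position in \<open>D\<close>.\<close>

fun edd_chunks :: "real \<Rightarrow> nat \<Rightarrow> bool list list \<Rightarrow> bool list list \<Rightarrow> bool list" where
  "edd_chunks \<beta> l D [] = []"
| "edd_chunks \<beta> l D (z # zs) =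
     (if \<exists>d\<in>set D. close \<beta> l z d
      then let c = (LEAST i. i < length D \<and> close \<beta> l z (D ! i))
           in False # to_bits (index_width (length D)) c @ diff_code \<beta> l (diff_set z (D ! c))
                @ edd_chunks \<beta> l D zs
      else True # z @ edd_chunks \<beta> l (D @ [z]) zs)"

definition edd_encode :: "real \<Rightarrow> nat \<Rightarrow> bool list \<Rightarrow> bool list" where
  "edd_encode \<beta> l s = elias_gamma (length s) @ edd_chunks \<beta> l [] (chunks l s)"

definition edd_expected_length :: "nat \<Rightarrow> nat \<Rightarrow> nat \<Rightarrow> real \<Rightarrow> nat \<Rightarrow> real \<Rightarrow> real" where
  "edd_expected_length A B L \<delta> l \<beta> =
     measure_pmf.expectation (source_pmf A B L \<delta>) (\<lambda>s. real (length (edd_encode \<beta> l s)))"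

end

theory Submission
  imports Defs "HOL-Real_Asymp.Real_Asymp"
begin

text \<open>
  For the lower bound no decoder is needed: the Kraft sum of the chunk code is bounded by
  induction on the number of chunks, since a dictionary of \<open>t\<close> entries has at most \<open>t\<close> times the
  number of difference patterns many strings close to it. Gibbs' inequality then gives
  \<open>H(s) \<le> E[L(s)]\<close>.

  For the upper bound, \<open>H(s) \<ge> B L H(\<delta>)\<close> because conditioning on the source symbols and on the
  indices leaves only the independent bit flips. On the other side, a chunk that finds a close
  dictionary entry costs \<open>H(2\<beta>) L + O(log B)\<close> bits. Two chunks within distance \<open>\<beta> L\<close> of the same
  source symbol are close, so apart from at most \<open>A = o(B)\<close> chunks every new dictionary entry is
  at distance more than \<open>\<beta> L\<close> from its source symbol, which by Hoeffding's inequality happens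
  with probability \<open>exp (- 2 L (\<beta> - \<delta>)\<^sup>2)\<close> at most.
\<close>

section \<open>Finitely supported distributions\<close>

lemma expectation_mono_finite:
  fixes f g :: "'a \<Rightarrow> real"
  assumes "finite (set_pmf p)" "\<And>x. x \<in> set_pmf p \<Longrightarrow> f x \<le> g x"
  shows "measure_pmf.expectation p f \<le> measure_pmf.expectation p g"
  using assms by (intro integral_mono_AE integrable_measure_pmf_finite) (auto simp: AE_measure_pmf_iff)

lemma expectation_cong:
  assumes "\<And>x. x \<in> set_pmf p \<Longrightarrow> f x = g x"
  shows "measure_pmf.expectation p f = measure_pmf.expectation p (g :: _ \<Rightarrow> real)"
  using assms by (intro integral_cong_AE) (auto simp: AE_measure_pmf_iff)

lemma expectation_bind_finite:
  fixes h :: "'b \<Rightarrow> real"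
  assumes "finite (set_pmf p)" "\<And>x. x \<in> set_pmf p \<Longrightarrow> finite (set_pmf (f x))"
  shows "measure_pmf.expectation (p \<bind> f) h
    = measure_pmf.expectation p (\<lambda>x. measure_pmf.expectation (f x) h)"
  using assms by (subst pmf_expectation_bind[of "set_pmf p"], simp_all)
    (subst integral_measure_pmf[of "set_pmf p"], simp_all)

lemma finite_set_replicate_pmf:
  "finite (set_pmf p) \<Longrightarrow> finite (set_pmf (replicate_pmf n p))"
  using finite_lists_length_eq[of "set_pmf p" n]
  by (simp add: set_replicate_pmf lists_eq_set conj_commute)

text \<open>Exhibits the head as independent of the tail, so that inductions on \<open>n\<close>
  reduce to a product of two distributions.\<close>

lemma replicate_pmf_Suc_pair:
  "replicate_pmf (Suc n) p = map_pmf (\<lambda>(x, xs). x # xs) (pair_pmf p (replicate_pmf n p))"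
  by (simp add: pair_pmf_def map_bind_pmf)

lemma expectation_pair_add:
  fixes f :: "'a \<Rightarrow> real" and g :: "'b \<Rightarrow> real"
  assumes "finite (set_pmf p)" "finite (set_pmf q)"
  shows "measure_pmf.expectation (pair_pmf p q) (\<lambda>z. f (fst z) + g (snd z))
    = measure_pmf.expectation p f + measure_pmf.expectation q g"
  using assms by (subst Bochner_Integration.integral_add) (auto intro: integrable_measure_pmf_finite)

lemma expectation_replicate_sum_list:
  fixes f :: "'a \<Rightarrow> real"
  assumes fin: "finite (set_pmf p)"
  shows "measure_pmf.expectation (replicate_pmf n p) (\<lambda>xs. \<Sum>x\<leftarrow>xs. f x)
    = real n * measure_pmf.expectation p f"
proof (induction n)
  case (Suc n)
  then show ?case
    using expectation_pair_add[OF fin finite_set_replicate_pmf[OF fin, of n],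
        of f "\<lambda>xs. \<Sum>x\<leftarrow>xs. f x"]
    by (simp only: replicate_pmf_Suc_pair integral_map_pmf)
       (simp add: case_prod_unfold distrib_right)
qed simp

section \<open>Entropy\<close>

lemma shannon_entropy_eq_expectation:
  fixes p :: "'a :: countable pmf"
  assumes "finite (set_pmf p)"
  shows "shannon_entropy p = measure_pmf.expectation p (\<lambda>x. - log 2 (pmf p x))"
  using assms
  by (subst shannon_entropy_eq_sum, simp)
     (subst integral_measure_pmf[of "set_pmf p"], auto simp: sum_negf)

text \<open>From ln x \<le> x - 1 at \<open>q x / pmf p x\<close>. The weights \<open>q\<close> may
  sum to less than 1 on the support, which admits Kraft weights as well as a mixture restricted to
  the support of one of its components.\<close>

lemma gibbs_inequality:
  fixes p :: "'a :: countable pmf"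
  assumes fin: "finite (set_pmf p)" and pos: "\<And>x. x \<in> set_pmf p \<Longrightarrow> 0 < q x"
    and le1: "(\<Sum>x\<in>set_pmf p. q x) \<le> 1"
  shows "shannon_entropy p \<le> measure_pmf.expectation p (\<lambda>x. - log 2 (q x))"
proof -
  have "pmf p x * (log 2 (q x) - log 2 (pmf p x)) \<le> (q x - pmf p x) / ln 2"
    if "x \<in> set_pmf p" for x
  proof -
    have p: "0 < pmf p x" using that by (simp add: pmf_positive)
    have "log 2 (q x) - log 2 (pmf p x) = ln (q x / pmf p x) / ln 2"
      using p pos[OF that] by (simp add: log_def ln_div diff_divide_distrib)
    also have "\<dots> \<le> (q x / pmf p x - 1) / ln 2"
      using p pos[OF that] by (intro divide_right_mono ln_le_minus_one) auto
    finally have "pmf p x * (log 2 (q x) - log 2 (pmf p x))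
        \<le> pmf p x * ((q x / pmf p x - 1) / ln 2)"
      using p by (intro mult_left_mono) auto
    also have "\<dots> = (q x - pmf p x) / ln 2" using p by (simp add: field_simps)
    finally show ?thesis .
  qed
  then have "(\<Sum>x\<in>set_pmf p. pmf p x * (log 2 (q x) - log 2 (pmf p x)))
      \<le> (\<Sum>x\<in>set_pmf p. (q x - pmf p x) / ln 2)"
    by (intro sum_mono) auto
  also have "\<dots> = ((\<Sum>x\<in>set_pmf p. q x) - 1) / ln 2"
    using sum_pmf_eq_1[OF fin order_refl] by (simp add: sum_subtractf flip: sum_divide_distrib)
  also have "\<dots> \<le> 0" using le1 by (simp add: divide_nonpos_pos)
  finally have "(\<Sum>x\<in>set_pmf p. pmf p x * (log 2 (q x) - log 2 (pmf p x))) \<le> 0" .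
  moreover have "measure_pmf.expectation p (\<lambda>x. - log 2 (q x)) = (\<Sum>x\<in>set_pmf p. pmf p x * - log 2 (q x))"
    using fin by (subst integral_measure_pmf[of "set_pmf p"]) auto
  ultimately show ?thesis
    by (simp add: shannon_entropy_eq_sum[OF fin] right_diff_distrib sum_subtractf sum_negf)
qed

lemma shannon_entropy_map_inj:
  fixes p :: "'a :: countable pmf" and f :: "'a \<Rightarrow> 'b :: countable"
  assumes fin: "finite (set_pmf p)" and inj: "inj_on f (set_pmf p)"
  shows "shannon_entropy (map_pmf f p) = shannon_entropy p"
  using fin inj
  by (simp add: shannon_entropy_eq_sum sum.reindex pmf_map_inj)

lemma shannon_entropy_pair:
  fixes p :: "'a :: countable pmf" and q :: "'b :: countable pmf"
  assumes fin: "finite (set_pmf p)" "finite (set_pmf q)"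
  shows "shannon_entropy (pair_pmf p q) = shannon_entropy p + shannon_entropy q"
proof -
  have "- log 2 (pmf (pair_pmf p q) z) = - log 2 (pmf p (fst z)) + - log 2 (pmf q (snd z))"
    if "z \<in> set_pmf (pair_pmf p q)" for z
    using that by (cases z) (auto simp: pmf_pair log_mult pmf_positive set_pmf_iff)
  then show ?thesis
    using fin by (simp only: shannon_entropy_eq_expectation set_pair_pmf finite_cartesian_product
          expectation_pair_add[symmetric]) (rule expectation_cong, simp)
qed

lemma shannon_entropy_replicate:
  fixes p :: "'a :: countable pmf"
  assumes fin: "finite (set_pmf p)"
  shows "shannon_entropy (replicate_pmf n p) = real n * shannon_entropy p"
proof (induction n)
  case 0
  then show ?case by (simp add: shannon_entropy_eq_sum)
next
  case (Suc n)
  have "shannon_entropy (replicate_pmf (Suc n) p)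
      = shannon_entropy (pair_pmf p (replicate_pmf n p))"
    unfolding replicate_pmf_Suc_pair
    using fin finite_set_replicate_pmf[OF fin, of n]
    by (intro shannon_entropy_map_inj) (auto intro: inj_onI)
  then show ?case
    using Suc fin finite_set_replicate_pmf[OF fin, of n]
    by (simp add: shannon_entropy_pair distrib_right del: replicate_pmf.simps)
qed

text \<open>Conditioning does not increase entropy: by Gibbs' inequality the entropy of each
  \<open>f x\<close> is at most its cross-entropy with the mixture, and these cross-entropies
  average to the entropy of the mixture.\<close>

lemma shannon_entropy_bind_ge:
  fixes f :: "'a \<Rightarrow> 'b :: countable pmf"
  assumes fin: "finite (set_pmf p)" "\<And>x. x \<in> set_pmf p \<Longrightarrow> finite (set_pmf (f x))"
    and ge: "\<And>x. x \<in> set_pmf p \<Longrightarrow> h \<le> shannon_entropy (f x)"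
  shows "h \<le> shannon_entropy (p \<bind> f)"
proof -
  let ?m = "p \<bind> f"
  have finm: "finite (set_pmf ?m)" using fin by auto
  have "h = measure_pmf.expectation p (\<lambda>_. h)" by simp
  also have "\<dots> \<le> measure_pmf.expectation p
      (\<lambda>x. measure_pmf.expectation (f x) (\<lambda>y. - log 2 (pmf ?m y)))"
  proof (rule expectation_mono_finite[OF fin(1)])
    fix x assume x: "x \<in> set_pmf p"
    have sub: "set_pmf (f x) \<subseteq> set_pmf ?m" using x by auto
    have "(\<Sum>y\<in>set_pmf (f x). pmf ?m y) \<le> (\<Sum>y\<in>set_pmf ?m. pmf ?m y)"
      using finm sub by (intro sum_mono2) auto
    also have "\<dots> = 1" using sum_pmf_eq_1[OF finm order_refl] .
    finally have "shannon_entropy (f x)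
        \<le> measure_pmf.expectation (f x) (\<lambda>y. - log 2 (pmf ?m y))"
      using sub fin(2)[OF x] by (intro gibbs_inequality pmf_positive) blast+
    with ge[OF x] show "h \<le> measure_pmf.expectation (f x) (\<lambda>y. - log 2 (pmf ?m y))" by simp
  qed
  also have "\<dots> = shannon_entropy ?m"
    using fin finm by (simp add: shannon_entropy_eq_expectation expectation_bind_finite)
  finally show ?thesis .
qed

lemma shannon_entropy_bernoulli:
  assumes "0 < p" "p < 1"
  shows "shannon_entropy (bernoulli_pmf p) = binary_entropy p"
  using assms by (simp add: shannon_entropy_eq_expectation finite_subset[OF subset_UNIV]
      binary_entropy_def log_divide algebra_simps)

lemma binary_entropy_pos:
  assumes "0 < p" "p < 1"
  shows "0 < binary_entropy p"
proof -
  have "0 < log 2 (1 / p)" "0 < log 2 (1 / (1 - p))" using assms by auto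
  then show ?thesis using assms by (simp add: binary_entropy_def add_pos_pos)
qed

section \<open>The entropy of the source\<close>

lemma length_of_edit: "y \<in> set_pmf (edit_pmf \<delta> x) \<Longrightarrow> length y = length x"
  by (auto simp: edit_pmf_def set_replicate_pmf)

lemma finite_set_edit_pmf: "finite (set_pmf (edit_pmf \<delta> x))"
  unfolding edit_pmf_def by (simp add: finite_set_replicate_pmf finite_subset[OF subset_UNIV])

lemma map2_neq_inject:
  fixes x :: "bool list"
  assumes "length f = length x" "length g = length x" "map2 (\<noteq>) x f = map2 (\<noteq>) x g"
  shows "f = g"
proof (rule nth_equalityI)
  fix i assume i: "i < length f"
  have "map2 (\<noteq>) x f ! i = map2 (\<noteq>) x g ! i" using assms by simp
  then show "f ! i = g ! i" using assms i by auto
qed (use assms in simp)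

text \<open>For fixed \<open>x\<close> the edited string determines the flips, so the entropy is
  that of independent Bernoulli bits.\<close>

lemma shannon_entropy_edit:
  assumes "0 < \<delta>" "\<delta> < 1"
  shows "shannon_entropy (edit_pmf \<delta> x) = real (length x) * binary_entropy \<delta>"
proof -
  have "inj_on (map2 (\<noteq>) x) (set_pmf (replicate_pmf (length x) (bernoulli_pmf \<delta>)))"
    by (rule inj_onI) (metis (mono_tags, lifting) map2_neq_inject set_replicate_pmf mem_Collect_eq)
  then show ?thesis
    using assms unfolding edit_pmf_def
    by (simp add: shannon_entropy_map_inj finite_set_replicate_pmf finite_subset[OF subset_UNIV]
        shannon_entropy_replicate shannon_entropy_bernoulli)
qed

section \<open>The data stream as a concatenation of blocks\<close>

definition block_pmf :: "real \<Rightarrow> bool list list \<Rightarrow> bool list pmf" where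
  "block_pmf \<delta> X = pmf_of_set {..<length X} \<bind> (\<lambda>j. edit_pmf \<delta> (X ! j))"

text \<open>Contains the supports of both the source symbols (\<open>n = A\<close>) and the parsed
  data stream (\<open>n = B\<close>).\<close>

definition blocks :: "nat \<Rightarrow> nat \<Rightarrow> bool list list set" where
  "blocks n l = {zs. length zs = n \<and> (\<forall>z\<in>set zs. length z = l)}"

text \<open>The chunk length equals the symbol length, so parsing recovers the blocks exactly and no
  short final chunk occurs. Hence \<open>chunks l\<close> also serves as a left inverse of
  \<open>concat\<close>.\<close>

lemma chunks_concat:
  assumes "0 < l" "\<forall>z\<in>set zs. length z = l"
  shows "chunks l (concat zs) = zs"
  using assms(2)
proof (induction zs)
  case (Cons z zs)
  then show ?case using assms(1) by (subst chunks.simps) (auto simp flip: length_greater_0_conv)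
qed (simp add: chunks.simps)

lemma inj_on_concat_blocks: "0 < l \<Longrightarrow> inj_on concat (blocks n l)"
  by (rule inj_on_inverseI[of _ "chunks l"]) (simp add: blocks_def chunks_concat)

lemma finite_strings: "finite {x :: bool list. length x = l}"
  using finite_lists_length_eq[of "UNIV :: bool set" l] by simp

lemma strings_nonempty: "{x :: bool list. length x = l} \<noteq> {}"
  using Ex_list_of_length by auto

lemma finite_blocks: "finite (blocks n l)"
  using finite_lists_length_eq[OF finite_strings[of l], of n]
  by (rule finite_subset[rotated]) (auto simp: blocks_def)

lemma set_symbols_pmf:
  "set_pmf (replicate_pmf n (pmf_of_set {x :: bool list. length x = l})) = blocks n l"
  by (auto simp: set_replicate_pmf set_pmf_of_set[OF strings_nonempty finite_strings] blocks_def
      lists_eq_set)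

lemma finite_block_pmf: "X \<noteq> [] \<Longrightarrow> finite (set_pmf (block_pmf \<delta> X))"
  by (simp add: block_pmf_def finite_set_edit_pmf lessThan_empty_iff)

lemma set_data_blocks:
  assumes "X \<in> blocks A l" "0 < A"
  shows "set_pmf (replicate_pmf B (block_pmf \<delta> X)) \<subseteq> blocks B l"
  using assms by (fastforce simp: set_replicate_pmf blocks_def block_pmf_def lessThan_empty_iff
      dest: length_of_edit)

text \<open>Given the symbols \<open>X\<close>, the blocks are independent with the common law
  \<open>block_pmf \<delta> X\<close>, in which the index is already averaged out. The entropy bound
  and the upper bound on the code length both condition on \<open>X\<close> in this form.\<close>

lemma source_pmf_alt:
  assumes "0 < A"
  shows "source_pmf A B L \<delta> = replicate_pmf A (pmf_of_set {x. length x = L}) \<bind>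
    (\<lambda>X. map_pmf concat (replicate_pmf B (block_pmf \<delta> X)))"
  unfolding source_pmf_def
  by (intro bind_pmf_cong refl) (auto simp: set_symbols_pmf blocks_def block_pmf_def map_pmf_def)

lemma set_source_pmf:
  assumes "0 < A"
  shows "set_pmf (source_pmf A B L \<delta>) \<subseteq> concat ` blocks B L"
  using set_data_blocks[OF _ assms] by (fastforce simp: source_pmf_alt[OF assms] set_symbols_pmf)

lemma source_entropy_ge:
  assumes A: "0 < A" and L: "0 < L" and d: "0 < \<delta>" "\<delta> < 1"
  shows "real B * (real L * binary_entropy \<delta>) \<le> shannon_entropy (source_pmf A B L \<delta>)"
  unfolding source_pmf_alt[OF A]
proof (rule shannon_entropy_bind_ge)
  fix X :: "bool list list"
  assume "X \<in> set_pmf (replicate_pmf A (pmf_of_set {x. length x = L}))"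
  then have X: "X \<in> blocks A L" by (simp add: set_symbols_pmf)
  then have ne: "X \<noteq> []" using A by (auto simp: blocks_def)
  note fin = finite_block_pmf[OF ne, of \<delta>]
  \<comment> \<open>A second conditioning, now on the index of a single block.\<close>
  have "real L * binary_entropy \<delta> \<le> shannon_entropy (block_pmf \<delta> X)"
    unfolding block_pmf_def using X ne d
    by (intro shannon_entropy_bind_ge)
       (auto simp: shannon_entropy_edit blocks_def finite_set_edit_pmf lessThan_empty_iff)
  moreover have "inj_on concat (set_pmf (replicate_pmf B (block_pmf \<delta> X)))"
    using inj_on_subset[OF inj_on_concat_blocks[OF L] set_data_blocks[OF X A]] .
  ultimately show "real B * (real L * binary_entropy \<delta>)
      \<le> shannon_entropy (map_pmf concat (replicate_pmf B (block_pmf \<delta> X)))"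
    using fin by (simp add: shannon_entropy_map_inj finite_set_replicate_pmf
        shannon_entropy_replicate mult_left_mono)
  show "finite (set_pmf (map_pmf concat (replicate_pmf B (block_pmf \<delta> X))))"
    using fin by (simp add: finite_set_replicate_pmf)
qed (simp add: set_symbols_pmf finite_blocks)

section \<open>Kraft's inequality for the chunk code\<close>

lemma le_two_power_index_width: "n \<le> 2 ^ index_width n"
proof (cases "n = 0")
  case False
  have "real n = 2 powr log 2 (real n)" using False by simp
  also have "\<dots> \<le> 2 powr real (index_width n)"
    unfolding index_width_def by (intro powr_mono) linarith+
  also have "\<dots> = real (2 ^ index_width n)" by (simp add: powr_realpow)
  finally show ?thesis by (simp only: of_nat_le_iff)
qed simp

lemma index_width_le: "1 \<le> n \<Longrightarrow> real (index_width n) \<le> log 2 (real n) + 1"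
  using zero_le_log_cancel_iff[of 2 "real n"] unfolding index_width_def by linarith

lemma index_width_mono:
  assumes "m \<le> n"
  shows "index_width m \<le> index_width n"
proof (cases "m = 0")
  case True
  \<comment> \<open>By convention \<open>log 2 0\<close> is 0, so the pointer width of an empty
    dictionary is 0.\<close>
  have "log 2 0 = (0 :: real)" by (simp only: log_def ln_0 div_0)
  then show ?thesis using True by (simp add: index_width_def)
next
  case False
  then have "log 2 (real m) \<le> log 2 (real n)" using assms by simp
  then show ?thesis unfolding index_width_def by (intro nat_mono ceiling_mono)
qed

definition pattern_count :: "real \<Rightarrow> nat \<Rightarrow> nat" where
  "pattern_count \<beta> l = (\<Sum>i\<le>nat \<lfloor>2 * \<beta> * real l\<rfloor>. l choose i)"

lemma length_to_bits [simp]: "length (to_bits w n) = w"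
  by (simp add: to_bits_def)

lemma length_diff_code [simp]: "length (diff_code \<beta> l S) = index_width (pattern_count \<beta> l)"
  by (simp add: diff_code_def pattern_count_def)

lemma finite_diff_patterns: "finite (diff_patterns \<beta> l)"
  by (rule finite_subset[of _ "Pow {..<l}"]) (auto simp: diff_patterns_def)

lemma card_diff_patterns: "card (diff_patterns \<beta> l) = pattern_count \<beta> l"
proof -
  let ?S = "\<lambda>i. {S. S \<subseteq> {..<l} \<and> card S = i}"
  have "diff_patterns \<beta> l = (\<Union>i\<le>nat \<lfloor>2 * \<beta> * real l\<rfloor>. ?S i)"
    by (auto simp: diff_patterns_def)
  also have "card \<dots> = (\<Sum>i\<le>nat \<lfloor>2 * \<beta> * real l\<rfloor>. card (?S i))"
    by (rule card_UN_disjoint) auto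
  also have "\<dots> = pattern_count \<beta> l"
    by (simp add: pattern_count_def n_subsets)
  finally show ?thesis .
qed

lemma diff_set_inject:
  fixes x y d :: "bool list"
  assumes "length x = length d" "length y = length d" "diff_set x d = diff_set y d"
  shows "x = y"
  using assms by (intro nth_equalityI) (auto simp: diff_set_def set_eq_iff)

text \<open>A string is determined by \<open>d\<close> and its difference set from \<open>d\<close>,
  and closeness makes that set one of the \<open>diff_patterns\<close>.\<close>

lemma card_close_le:
  "card {z :: bool list. length z = l \<and> close \<beta> l z d} \<le> pattern_count \<beta> l"
proof -
  let ?Z = "{z :: bool list. length z = l \<and> close \<beta> l z d}"
  have "card ?Z \<le> card (diff_patterns \<beta> l)"
  proof (rule card_inj_on_le[of "\<lambda>z. diff_set z d"])
    show "inj_on (\<lambda>z. diff_set z d) ?Z"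
      by (rule inj_onI) (auto simp: close_def intro: diff_set_inject)
    show "(\<lambda>z. diff_set z d) ` ?Z \<subseteq> diff_patterns \<beta> l"
      by (auto simp: close_def diff_patterns_def le_nat_floor) (auto simp: diff_set_def)
  qed (rule finite_diff_patterns)
  then show ?thesis by (simp add: card_diff_patterns)
qed

lemma card_close_dictionary_le:
  "card {z :: bool list. length z = l \<and> (\<exists>d\<in>set D. close \<beta> l z d)} \<le> length D * pattern_count \<beta> l"
proof -
  have "{z. length z = l \<and> (\<exists>d\<in>set D. close \<beta> l z d)}
      = (\<Union>d\<in>set D. {z. length z = l \<and> close \<beta> l z d})" by auto
  also have "card \<dots> \<le> (\<Sum>d\<in>set D. card {z. length z = l \<and> close \<beta> l z d})"
    by (rule card_UN_le) simp
  also have "\<dots> \<le> (\<Sum>d\<in>set D. pattern_count \<beta> l)"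
    by (intro sum_mono card_close_le)
  also have "\<dots> \<le> length D * pattern_count \<beta> l"
    by (simp add: card_length)
  finally show ?thesis .
qed

lemma length_edd_chunks_Cons:
  "length (edd_chunks \<beta> l D (z # zs)) =
    (if \<exists>d\<in>set D. close \<beta> l z d
     then 1 + index_width (length D) + index_width (pattern_count \<beta> l)
       + length (edd_chunks \<beta> l D zs)
     else 1 + length z + length (edd_chunks \<beta> l (D @ [z]) zs))"
  by (simp add: Let_def)

lemma card_strings: "card {z :: bool list. length z = l} = 2 ^ l"
  using card_lists_length_eq[of "UNIV :: bool set" l] by simp

lemma blocks_Suc: "blocks (Suc n) l = (\<lambda>(z, zs). z # zs) ` ({z. length z = l} \<times> blocks n l)"
  by (auto simp: blocks_def length_Suc_conv image_iff)

text \<open>The two cases for the first chunk contribute at most 1/2 each: with w the sum of the two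
  index widths, at most 2^w strings are close to the dictionary and cost 1 + w bits, and at most 2^l
  strings are stored literally at 1 + l bits. The dictionary \<open>D\<close> stays arbitrary
  because the second case enlarges it.\<close>

lemma edd_chunks_kraft:
  "(\<Sum>zs\<in>blocks n l. (1/2 :: real) ^ length (edd_chunks \<beta> l D zs)) \<le> 1"
proof (induction n arbitrary: D)
  case 0
  have "blocks 0 l = {[]}" by (auto simp: blocks_def)
  then show ?case by simp
next
  case (Suc n)
  let ?S = "{z :: bool list. length z = l}"
  let ?C = "{z \<in> ?S. \<exists>d\<in>set D. close \<beta> l z d}"
  let ?w = "index_width (length D) + index_width (pattern_count \<beta> l)"
  let ?h = "\<lambda>z. if z \<in> ?C then (1/2 :: real) ^ (1 + ?w) else (1/2) ^ (1 + l)"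
  have "(\<Sum>zs\<in>blocks (Suc n) l. (1/2 :: real) ^ length (edd_chunks \<beta> l D zs))
      = (\<Sum>z\<in>?S. \<Sum>zs\<in>blocks n l. (1/2) ^ length (edd_chunks \<beta> l D (z # zs)))"
    unfolding blocks_Suc by (subst sum.reindex)
      (auto simp: sum.cartesian_product inj_on_def case_prod_unfold simp del: edd_chunks.simps)
  \<comment> \<open>The bits spent on the first chunk depend only on whether it is close to
    \<open>D\<close>, so they factor out of the sum over the remaining chunks.\<close>
  also have "\<dots> = (\<Sum>z\<in>?S. ?h z * (\<Sum>zs\<in>blocks n l.
      (1/2) ^ length (edd_chunks \<beta> l (if z \<in> ?C then D else D @ [z]) zs)))"
    by (rule sum.cong) (auto simp: length_edd_chunks_Cons power_add sum_distrib_left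
        simp del: edd_chunks.simps intro!: sum.cong)
  also have "\<dots> \<le> (\<Sum>z\<in>?S. ?h z * 1)"
    by (intro sum_mono mult_left_mono Suc.IH) auto
  also have "\<dots> = real (card ?C) * (1/2) ^ (1 + ?w) + real (card (?S - ?C)) * (1/2) ^ (1 + l)"
  proof -
    have 1: "?S \<inter> {z. z \<in> ?C} = ?C" by blast
    have 2: "?S \<inter> - {z. z \<in> ?C} = ?S - ?C" by blast
    show ?thesis
      unfolding mult_1_right sum.If_cases[OF finite_strings] 1 2 sum_constant ..
  qed
  also have "\<dots> \<le> 2 ^ ?w * (1/2) ^ (1 + ?w) + 2 ^ l * (1/2) ^ (1 + l)"
  proof (intro add_mono mult_right_mono)
    have "card ?C \<le> length D * pattern_count \<beta> l"
      using card_close_dictionary_le[of l D \<beta>] by simp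
    also have "\<dots> \<le> 2 ^ ?w"
      unfolding power_add by (intro mult_mono le_two_power_index_width) auto
    finally show "real (card ?C) \<le> 2 ^ ?w" by (simp only: of_nat_le_numeral_power_cancel_iff)
    have "card (?S - ?C) \<le> 2 ^ l"
      using card_mono[OF finite_strings, of "?S - ?C" l] by (simp add: card_strings)
    then show "real (card (?S - ?C)) \<le> 2 ^ l" by (simp only: of_nat_le_numeral_power_cancel_iff)
  qed auto
  also have "\<dots> = 1" by (simp add: power_one_over)
  finally show ?case .
qed

lemma edd_expected_length_ge_entropy:
  assumes A: "0 < A" and L: "0 < L"
  shows "shannon_entropy (source_pmf A B L \<delta>) \<le> edd_expected_length A B L \<delta> L \<beta>"
proof -
  let ?p = "source_pmf A B L \<delta>"
  let ?q = "\<lambda>s. (1/2 :: real) ^ length (edd_encode \<beta> L s)"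
  have fin: "finite (set_pmf ?p)"
    using finite_subset[OF set_source_pmf[OF A]] finite_blocks by blast
  have "(\<Sum>s\<in>set_pmf ?p. ?q s) \<le> (\<Sum>s\<in>concat ` blocks B L. ?q s)"
    using set_source_pmf[OF A] by (intro sum_mono2) (auto intro: finite_blocks)
  also have "\<dots> = (\<Sum>zs\<in>blocks B L. ?q (concat zs))"
    by (simp add: sum.reindex inj_on_concat_blocks[OF L])
  \<comment> \<open>Leaving out the Elias gamma prefix shortens every code word, which can only
    increase the sum.\<close>
  also have "\<dots> \<le> (\<Sum>zs\<in>blocks B L. (1/2) ^ length (edd_chunks \<beta> L [] zs))"
    by (intro sum_mono power_decreasing)
       (auto simp: edd_encode_def chunks_concat[OF L] blocks_def)
  also have "\<dots> \<le> 1" by (rule edd_chunks_kraft)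
  finally have "shannon_entropy ?p \<le> measure_pmf.expectation ?p (\<lambda>s. - log 2 (?q s))"
    by (intro gibbs_inequality fin) auto
  also have "\<dots> = edd_expected_length A B L \<delta> L \<beta>"
    by (simp add: edd_expected_length_def log_nat_power log_divide)
  finally show ?thesis .
qed

section \<open>The length of the encoding\<close>

text \<open>The entropy bound on a partial binomial sum: with \<open>p = 2 * \<beta>\<close>, each
  pattern of at most \<open>p * l\<close> positions has probability at least 2 to the power -H(p) l
  under independent flips of probability \<open>p\<close>, and these probabilities sum to at most
  1.\<close>

lemma log2_pattern_count_le:
  assumes "0 < \<beta>" "\<beta> \<le> 1/4"
  shows "log 2 (real (pattern_count \<beta> l)) \<le> binary_entropy (2 * \<beta>) * real l"
proof -
  define p where "p = 2 * \<beta>"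
  define k where "k = nat \<lfloor>p * real l\<rfloor>"
  have p: "0 < p" "p \<le> 1/2" using assms by (auto simp: p_def)
  have k: "real k \<le> p * real l" using p unfolding k_def by simp
  have "real k \<le> real l" using k p mult_right_mono[of p 1 "real l"] by simp
  then have kl: "k \<le> l" by simp
  have "p powr (p * l) * (1 - p) powr (l - p * l) \<le> p ^ i * (1 - p) ^ (l - i)" if "i \<le> k" for i
  proof -
    have i: "real i \<le> p * l" "i \<le> l" using that k kl by auto
    have "p powr (p * l) * (1 - p) powr (l - p * l)
        = p powr i * (p powr (p * l - i) * (1 - p) powr (l - p * l))"
      using p by (simp flip: powr_add mult.assoc)
    \<comment> \<open>The surplus exponent \<open>p * l - i\<close> is nonnegative, and
      \<open>p \<le> 1 - p\<close> because \<beta> \<le> 1/4.\<close>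
    also have "\<dots> \<le> p powr i * ((1 - p) powr (p * l - i) * (1 - p) powr (l - p * l))"
      using p i by (intro mult_left_mono mult_right_mono powr_mono2) auto
    also have "\<dots> = p ^ i * (1 - p) ^ (l - i)"
      using p i powr_realpow[of "1 - p" "l - i"] by (simp add: powr_realpow flip: powr_add)
    finally show ?thesis .
  qed
  then have "(\<Sum>i\<le>k. real (l choose i) * (p powr (p * l) * (1 - p) powr (l - p * l)))
      \<le> (\<Sum>i\<le>k. real (l choose i) * (p ^ i * (1 - p) ^ (l - i)))"
    by (intro sum_mono mult_left_mono) auto
  also have "\<dots> \<le> (\<Sum>i\<le>l. real (l choose i) * (p ^ i * (1 - p) ^ (l - i)))"
    using kl p by (intro sum_mono2) auto
  also have "\<dots> = (p + (1 - p)) ^ l"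
    by (subst binomial_ring) (simp add: mult.assoc)
  finally have "real (pattern_count \<beta> l) * (p powr (p * l) * (1 - p) powr (l - p * l)) \<le> 1"
    by (simp add: pattern_count_def k_def p_def sum_distrib_right)
  moreover have pc: "0 < real (pattern_count \<beta> l)"
    unfolding pattern_count_def by (simp add: sum_pos2[of _ 0])
  ultimately have "log 2 (real (pattern_count \<beta> l) * (p powr (p * l) * (1 - p) powr (l - p * l))) \<le> 0"
    using p by simp
  moreover have "log 2 (real (pattern_count \<beta> l) * (p powr (p * l) * (1 - p) powr (l - p * l)))
      = log 2 (real (pattern_count \<beta> l)) + (p * l * log 2 p + (l - p * l) * log 2 (1 - p))"
    using p pc by (simp add: log_mult log_powr)
  moreover have "binary_entropy p * l = - (p * l * log 2 p + (l - p * l) * log 2 (1 - p))"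
    using p by (simp add: binary_entropy_def log_divide algebra_simps)
  ultimately show ?thesis unfolding p_def by linarith
qed

lemma length_elias_gamma_le:
  assumes "1 \<le> n"
  shows "real (length (elias_gamma n)) \<le> 2 * log 2 (real n) + 1"
proof -
  have "0 \<le> log 2 (real n)" using assms by simp
  then have "real (nat \<lfloor>log 2 (real n)\<rfloor>) \<le> log 2 (real n)" by simp
  then show ?thesis by (simp add: elias_gamma_def Let_def)
qed

text \<open>Half the radius of \<open>close\<close>, so that the triangle inequality makes two
  strings near a common centre close to each other.\<close>

definition near :: "real \<Rightarrow> nat \<Rightarrow> bool list \<Rightarrow> bool list \<Rightarrow> bool" where
  "near \<beta> l x y \<longleftrightarrow> length x = length y \<and> real (card (diff_set x y)) \<le> \<beta> * real l"

lemma close_if_near: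
  assumes "near \<beta> l x c" "near \<beta> l d c"
  shows "close \<beta> l x d"
proof -
  have "diff_set x d \<subseteq> diff_set x c \<union> diff_set d c"
    using assms by (auto simp: diff_set_def near_def)
  moreover have fin: "finite (diff_set x c \<union> diff_set d c)"
    by (rule finite_subset[of _ "{..<length x} \<union> {..<length d}"]) (auto simp: diff_set_def)
  ultimately have "card (diff_set x d) \<le> card (diff_set x c \<union> diff_set d c)"
    by (rule card_mono[rotated])
  also have "\<dots> \<le> card (diff_set x c) + card (diff_set d c)" by (rule card_Un_le)
  finally have "real (card (diff_set x d)) \<le> real (card (diff_set x c)) + real (card (diff_set d c))"
    by linarith
  then show ?thesis using assms by (simp add: near_def close_def)
qed

text \<open>A new chunk is either near no centre, or it is near a centre to which no dictionary entry
  was near before, since two chunks near the same centre are close. The number of such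
  centres is the potential that pays for the new chunks.\<close>

lemma length_edd_chunks_le:
  assumes "\<forall>z\<in>set zs. length z = l" "finite C" "length D + length zs \<le> M"
  shows "length (edd_chunks \<beta> l D zs) \<le>
    length zs * (1 + index_width M + index_width (pattern_count \<beta> l))
    + l * (card {c\<in>C. \<forall>d\<in>set D. \<not> near \<beta> l d c}
      + length (filter (\<lambda>z. \<forall>c\<in>C. \<not> near \<beta> l z c) zs))"
  using assms(1,3)
proof (induction zs arbitrary: D)
  case (Cons z zs)
  let ?U = "\<lambda>D. {c\<in>C. \<forall>d\<in>set D. \<not> near \<beta> l d c}"
  have finU: "finite (?U D)" for D using assms(2) by simp
  show ?case
  proof (cases "\<exists>d\<in>set D. close \<beta> l z d")
    case True
    have "index_width (length D) \<le> index_width M" using Cons.prems by (intro index_width_mono) simp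
    moreover have "l * length (filter (\<lambda>z. \<forall>c\<in>C. \<not> near \<beta> l z c) zs)
        \<le> l * length (filter (\<lambda>z. \<forall>c\<in>C. \<not> near \<beta> l z c) (z # zs))"
      by (intro mult_left_mono) auto
    moreover have "length (edd_chunks \<beta> l D (z # zs))
        = 1 + index_width (length D) + index_width (pattern_count \<beta> l) + length (edd_chunks \<beta> l D zs)"
      using True by (simp add: length_edd_chunks_Cons del: edd_chunks.simps)
    moreover have "length (z # zs) * (1 + index_width M + index_width (pattern_count \<beta> l))
        = (1 + index_width M + index_width (pattern_count \<beta> l))
          + length zs * (1 + index_width M + index_width (pattern_count \<beta> l))"
      by (simp only: list.size mult_Suc add_Suc_right add_0_right)
    moreover have "length (edd_chunks \<beta> l D zs) \<le>
        length zs * (1 + index_width M + index_width (pattern_count \<beta> l))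
        + l * (card (?U D) + length (filter (\<lambda>z. \<forall>c\<in>C. \<not> near \<beta> l z c) zs))"
      using Cons.prems by (intro Cons.IH) auto
    ultimately show ?thesis unfolding distrib_left[of l] by linarith
  next
    case False
    have sub: "?U (D @ [z]) \<subseteq> ?U D" by auto
    \<comment> \<open>A new entry costs \<open>1 + l\<close> bits. The drop of the potential by one,
      weighted by \<open>l\<close>, pays for the literal chunk; the flag bit is covered by the
      per-chunk term.\<close>
    have "card (?U (D @ [z])) + length (filter (\<lambda>z. \<forall>c\<in>C. \<not> near \<beta> l z c) zs) + 1
        \<le> card (?U D) + length (filter (\<lambda>z. \<forall>c\<in>C. \<not> near \<beta> l z c) (z # zs))"
    proof (cases "\<forall>c\<in>C. \<not> near \<beta> l z c")
      case True
      then show ?thesis using card_mono[OF finU sub] by simp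
    next
      case near: False
      then obtain c where c: "c \<in> C" "near \<beta> l z c" by blast
      \<comment> \<open>An older entry near \<open>c\<close> would be close to \<open>z\<close>,
        which \<open>False\<close> excludes.\<close>
      then have "c \<in> ?U D" "c \<notin> ?U (D @ [z])"
        using False close_if_near[OF c(2)] by auto
      then have "card (?U (D @ [z])) < card (?U D)"
        using sub by (intro psubset_card_mono finU) blast
      then show ?thesis using near by auto
    qed
    then have "l * (card (?U (D @ [z])) + length (filter (\<lambda>z. \<forall>c\<in>C. \<not> near \<beta> l z c) zs) + 1)
        \<le> l * (card (?U D) + length (filter (\<lambda>z. \<forall>c\<in>C. \<not> near \<beta> l z c) (z # zs)))"
      by (rule mult_left_mono) simp
    moreover have "length (edd_chunks \<beta> l (D @ [z]) zs) \<le>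
        length zs * (1 + index_width M + index_width (pattern_count \<beta> l))
        + l * (card (?U (D @ [z])) + length (filter (\<lambda>z. \<forall>c\<in>C. \<not> near \<beta> l z c) zs))"
      using Cons.prems by (intro Cons.IH) auto
    ultimately show ?thesis
      using False Cons.prems
      by (simp add: length_edd_chunks_Cons distrib_left del: edd_chunks.simps filter.simps)
  qed
qed simp

section \<open>The expected number of chunks far from all source symbols\<close>

lemma diff_set_map2_neq:
  assumes "length f = length x"
  shows "card (diff_set (map2 (\<noteq>) x f) x) = length (filter id f)"
proof -
  have "diff_set (map2 (\<noteq>) x f) x = {i. i < length f \<and> id (f ! i)}"
    using assms by (auto simp: diff_set_def)
  then show ?thesis by (simp add: length_filter_conv_card)
qed

text \<open>The Hamming distance from \<open>x\<close> to its edit is the number of flips, which is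
  binomial. A far edit exceeds the mean by at least \<open>\<beta> - \<delta>\<close> per bit, so
  Hoeffding's inequality applies.\<close>

lemma prob_edit_far_le:
  assumes d: "0 < \<delta>" "\<delta> < \<beta>" "\<beta> \<le> 1" and l: "0 < length x"
  shows "measure_pmf.prob (edit_pmf \<delta> x) {y. \<not> near \<beta> (length x) y x}
    \<le> exp (- 2 * real (length x) * (\<beta> - \<delta>)\<^sup>2)"
proof -
  let ?l = "length x"
  let ?R = "replicate_pmf ?l (bernoulli_pmf \<delta>)"
  have "measure_pmf.prob (edit_pmf \<delta> x) {y. \<not> near \<beta> ?l y x}
      = measure_pmf.prob ?R {f. \<not> near \<beta> ?l (map2 (\<noteq>) x f) x}"
    by (simp add: edit_pmf_def vimage_def)
  \<comment> \<open>The inclusion of events is claimed only on the support: a flip list of another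
    length could violate \<open>near\<close> through the length condition alone.\<close>
  also have "\<dots> \<le> measure_pmf.prob ?R {f. \<delta> + (\<beta> - \<delta>) \<le> real (length (filter id f)) / ?l}"
  proof (rule measure_pmf.finite_measure_mono_AE)
    show "AE f in ?R. f \<in> {f. \<not> near \<beta> ?l (map2 (\<noteq>) x f) x} \<longrightarrow>
        f \<in> {f. \<delta> + (\<beta> - \<delta>) \<le> real (length (filter id f)) / ?l}"
      unfolding AE_measure_pmf_iff
    proof (intro ballI impI)
      fix f assume f: "f \<in> set_pmf ?R" and far: "f \<in> {f. \<not> near \<beta> ?l (map2 (\<noteq>) x f) x}"
      have len: "length f = ?l" using f by (simp add: set_replicate_pmf)
      then have "length (map2 (\<noteq>) x f) = ?l" by simp
      with far have "\<not> real (card (diff_set (map2 (\<noteq>) x f) x)) \<le> \<beta> * ?l"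
        unfolding near_def mem_Collect_eq by blast
      then have "\<beta> * ?l < real (length (filter id f))"
        unfolding diff_set_map2_neq[OF len] by (rule not_le_imp_less)
      then show "f \<in> {f. \<delta> + (\<beta> - \<delta>) \<le> real (length (filter id f)) / ?l}"
        using l by (simp add: field_simps)
    qed
  qed simp
  also have "\<dots> = measure_pmf.prob (binomial_pmf ?l \<delta>) {k. \<delta> + (\<beta> - \<delta>) \<le> real k / ?l}"
    using d by (simp add: binomial_pmf_altdef vimage_def)
  also have "\<dots> \<le> exp (- 2 * real ?l * (\<beta> - \<delta>)\<^sup>2)"
    using binomial_distribution.prob_ge'[of \<delta> ?l "\<beta> - \<delta>"] d l
    by (simp add: binomial_distribution_def)
  finally show ?thesis .
qed

text \<open>The code length is first bounded pointwise. For fixed symbols the only random term of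
  that bound is the number of chunks far from every symbol, and linearity of expectation turns it
  into \<open>B\<close> times a single-block probability.\<close>

lemma edd_expected_length_le:
  assumes A: "0 < A" and B: "0 < B" and L: "0 < L" and d: "0 < \<delta>" "\<delta> < \<beta>" "\<beta> \<le> 1/4"
  shows "edd_expected_length A B L \<delta> L \<beta> \<le> 2 * log 2 (real (B * L)) + 1
    + real B * (3 + log 2 (real B) + binary_entropy (2 * \<beta>) * real L)
    + real L * (real A + real B * exp (- 2 * real L * (\<beta> - \<delta>)\<^sup>2))"
    (is "_ \<le> ?e + ?b + real L * (real A + real B * ?r)")
proof -
  let ?far = "\<lambda>X z. \<forall>c\<in>set X. \<not> near \<beta> L z c"
  have len: "real (length (edd_encode \<beta> L (concat zs)))
      \<le> ?e + ?b + real L * real A + real L * (\<Sum>z\<leftarrow>zs. indicator {z. ?far X z} z)"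
    if X: "X \<in> blocks A L" and zs: "zs \<in> blocks B L" for X zs
  proof -
    have z: "\<forall>z\<in>set zs. length z = L" "length zs = B" using zs by (auto simp: blocks_def)
    have "length (concat zs) = B * L"
      using z by (simp add: length_concat sum_list_triv cong: map_cong)
    then have e: "real (length (elias_gamma (length (concat zs)))) \<le> ?e"
      using B L length_elias_gamma_le[of "B * L"] by simp
    \<comment> \<open>The empty pattern always counts; \<open>index_width_le\<close> requires a
      positive argument.\<close>
    have "1 \<le> pattern_count \<beta> L"
      using sum_mono2[of "{..nat \<lfloor>2 * \<beta> * real L\<rfloor>}" "{0}" "\<lambda>i. L choose i"]
      by (simp add: pattern_count_def)
    then have "real (1 + index_width B + index_width (pattern_count \<beta> L))
        \<le> 3 + log 2 (real B) + binary_entropy (2 * \<beta>) * real L"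
      using index_width_le[of B] index_width_le[of "pattern_count \<beta> L"]
        log2_pattern_count_le[of \<beta> L] B d by simp
    then have "real B * real (1 + index_width B + index_width (pattern_count \<beta> L)) \<le> ?b"
      by (rule mult_left_mono) simp
    moreover have "real (length (edd_chunks \<beta> L [] zs)) \<le>
        real (length zs * (1 + index_width B + index_width (pattern_count \<beta> L))
        + L * (card (set X) + length (filter (?far X) zs)))"
      using length_edd_chunks_le[of zs L "set X" "[]" B \<beta>] z by (simp only: of_nat_le_iff) simp
    \<comment> \<open>Symbols are drawn with replacement, so the number of distinct centres may fall
      below \<open>A\<close>.\<close>
    moreover have "L * card (set X) \<le> L * A"
      using card_length[of X] X by (auto simp: blocks_def)
    then have "real L * real (card (set X)) \<le> real L * real A"
      by (simp only: of_nat_le_iff flip: of_nat_mult)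
    moreover have "real (length (filter (?far X) zs)) = (\<Sum>z\<leftarrow>zs. indicator {z. ?far X z} z)"
      by (induction zs) (auto simp: indicator_def)
    ultimately show ?thesis
      using e z by (simp add: edd_encode_def chunks_concat[OF L] distrib_left)
  qed
  have inner: "measure_pmf.expectation (map_pmf concat (replicate_pmf B (block_pmf \<delta> X)))
      (\<lambda>s. real (length (edd_encode \<beta> L s))) \<le> ?e + ?b + real L * (real A + real B * ?r)"
    if X: "X \<in> blocks A L" for X
  proof -
    have ne: "X \<noteq> []" using X A by (auto simp: blocks_def)
    note fin = finite_block_pmf[OF ne, of \<delta>]
    note finR = finite_set_replicate_pmf[OF fin, of B]
    have "measure_pmf.expectation (block_pmf \<delta> X) (indicator {z. ?far X z})
        = measure_pmf.expectation (pmf_of_set {..<length X})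
          (\<lambda>j. measure_pmf.prob (edit_pmf \<delta> (X ! j)) {z. ?far X z})"
      unfolding block_pmf_def
      using ne by (subst expectation_bind_finite) (auto simp: finite_set_edit_pmf lessThan_empty_iff)
    also have "\<dots> \<le> measure_pmf.expectation (pmf_of_set {..<length X}) (\<lambda>j. ?r)"
    proof (rule expectation_mono_finite)
      fix j assume "j \<in> set_pmf (pmf_of_set {..<length X})"
      then have j: "X ! j \<in> set X" "length (X ! j) = L"
        using ne X by (auto simp: lessThan_empty_iff blocks_def)
      \<comment> \<open>A chunk far from all symbols is in particular far from the one it was edited
        from.\<close>
      have "measure_pmf.prob (edit_pmf \<delta> (X ! j)) {z. ?far X z}
          \<le> measure_pmf.prob (edit_pmf \<delta> (X ! j)) {z. \<not> near \<beta> L z (X ! j)}"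
        using j by (intro measure_pmf.finite_measure_mono) auto
      also have "\<dots> \<le> ?r" using prob_edit_far_le[of \<delta> \<beta> "X ! j"] j d L by simp
      finally show "measure_pmf.prob (edit_pmf \<delta> (X ! j)) {z. ?far X z} \<le> ?r" .
    qed (use ne in \<open>simp add: lessThan_empty_iff\<close>)
    finally have far: "measure_pmf.expectation (block_pmf \<delta> X) (indicator {z. ?far X z}) \<le> ?r"
      by simp
    have "measure_pmf.expectation (replicate_pmf B (block_pmf \<delta> X))
        (\<lambda>zs. real (length (edd_encode \<beta> L (concat zs))))
      \<le> measure_pmf.expectation (replicate_pmf B (block_pmf \<delta> X))
        (\<lambda>zs. ?e + ?b + real L * real A + real L * (\<Sum>z\<leftarrow>zs. indicator {z. ?far X z} z))"
      using len[OF X] set_data_blocks[OF X A] by (intro expectation_mono_finite finR) blast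
    also have "\<dots> = ?e + ?b + real L * real A
        + real L * (real B * measure_pmf.expectation (block_pmf \<delta> X) (indicator {z. ?far X z}))"
      using finR by (subst Bochner_Integration.integral_add)
        (auto intro: integrable_measure_pmf_finite simp: expectation_replicate_sum_list[OF fin])
    also have "\<dots> \<le> ?e + ?b + real L * real A + real L * (real B * ?r)"
      using far by (intro add_left_mono mult_left_mono) auto
    finally show ?thesis by (simp add: distrib_left)
  qed
  have fin: "finite (set_pmf (replicate_pmf A (pmf_of_set {x :: bool list. length x = L})))"
    by (simp add: set_symbols_pmf finite_blocks)
  have "edd_expected_length A B L \<delta> L \<beta>
      = measure_pmf.expectation (replicate_pmf A (pmf_of_set {x. length x = L}))
        (\<lambda>X. measure_pmf.expectation (map_pmf concat (replicate_pmf B (block_pmf \<delta> X)))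
          (\<lambda>s. real (length (edd_encode \<beta> L s))))"
    unfolding edd_expected_length_def source_pmf_alt[OF A]
  proof (rule expectation_bind_finite[OF fin])
    fix X :: "bool list list"
    assume "X \<in> set_pmf (replicate_pmf A (pmf_of_set {x. length x = L}))"
    then have "X \<noteq> []" using A by (auto simp: set_symbols_pmf blocks_def)
    then show "finite (set_pmf (map_pmf concat (replicate_pmf B (block_pmf \<delta> X))))"
      by (simp add: finite_set_replicate_pmf finite_block_pmf)
  qed
  also have "\<dots> \<le> measure_pmf.expectation (replicate_pmf A (pmf_of_set {x :: bool list. length x = L}))
      (\<lambda>X. ?e + ?b + real L * (real A + real B * ?r))"
    using inner by (intro expectation_mono_finite fin) (auto simp: set_symbols_pmf)
  finally show ?thesis by simp
qed

section \<open>Asymptotics of the ratio of expected code length to entropy\<close>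

theorem theorem9:
  fixes A L :: "nat \<Rightarrow> nat" and k1 k2 \<delta> \<beta> :: real
  assumes "0 < k1" and "0 < k2" and "k2 < 1"
    and "\<And>B. 1 \<le> B \<Longrightarrow> 1 \<le> A B" and "\<And>B. 1 \<le> B \<Longrightarrow> 1 \<le> L B"
    and "filterlim A at_top at_top" and "filterlim L at_top at_top"
    and "\<forall>\<^sub>F B in at_top. real (A B) \<le> real B powr (1 - k2)"
    and "(\<lambda>B. real (L B)) \<in> \<Theta>(\<lambda>B. real B powr k1)"
    and "0 < \<delta>" and "\<delta> < 1/4" and "\<delta> < \<beta>" and "\<beta> \<le> 1/4"
  shows "\<exists>\<epsilon> :: nat \<Rightarrow> real. \<epsilon> \<in> o(\<lambda>_. 1) \<and>
    (\<forall>B\<ge>1. let ratio = edd_expected_length (A B) B (L B) \<delta> (L B) \<beta>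
                         / shannon_entropy (source_pmf (A B) B (L B) \<delta>)
            in 1 \<le> ratio \<and>
               ratio \<le> binary_entropy (2 * \<beta>) / binary_entropy \<delta> * (1 + \<epsilon> B))"
proof -
  define h where "h = binary_entropy (2 * \<beta>)"
  define e where "e B = edd_expected_length (A B) B (L B) \<delta> (L B) \<beta>" for B
  define s where "s B = shannon_entropy (source_pmf (A B) B (L B) \<delta>)" for B
  \<comment> \<open>The exact relative excess of the expected length over \<open>B * L * h\<close>,
    cut off at 0. With this choice the upper bound on the ratio holds for every
    \<open>B \<ge> 1\<close>, and only the convergence of \<epsilon> to 0 requires
    asymptotics.\<close>
  define \<epsilon> where "\<epsilon> B = max 0 (e B / (real B * real (L B) * h) - 1)" for B
  \<comment> \<open>The relative overhead. Its terms, in order, come from the length header; the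
    flags, pointers and roundings; the first entries near each symbol; and the far chunks.\<close>
  define g where "g B = ((2 * log 2 (real B) + 3) / real B + (3 + log 2 (real B)) / real (L B)
      + real (A B) / real B + exp (- 2 * real (L B) * (\<beta> - \<delta>)\<^sup>2)) / h" for B
  have h: "0 < h" using assms by (simp add: h_def binary_entropy_pos)
  have hd: "0 < binary_entropy \<delta>" using assms by (simp add: binary_entropy_pos)
  have lower: "real B * (real (L B) * binary_entropy \<delta>) \<le> s B" and es: "s B \<le> e B"
    if "1 \<le> B" for B
    using source_entropy_ge[of "A B" "L B" \<delta> B] edd_expected_length_ge_entropy[of "A B" "L B" B \<delta> \<beta>]
      assms(4,5)[OF that] assms(10,11) by (auto simp: s_def e_def)
  have L: "LIM B at_top. real (L B) :> at_top"
    using filterlim_compose[OF filterlim_real_sequentially assms(7)] .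
  have "\<epsilon> \<longlonglongrightarrow> 0"
  proof (rule tendsto_sandwich[where f = "\<lambda>_. 0"])
    show "\<forall>\<^sub>F B in at_top. \<epsilon> B \<le> g B"
      using eventually_gt_at_top[of 0]
    proof eventually_elim
      case (elim B)
      then have B: "1 \<le> B" by simp
      note AL = assms(4,5)[OF B]
      let ?l = "real (L B)"
      define r where "r = exp (- 2 * ?l * (\<beta> - \<delta>)\<^sup>2)"
      have l: "1 \<le> ?l" using AL by simp
      have "log 2 ?l \<le> ?l" using AL by (intro log2_of_power_le) (auto intro: less_imp_le)
      have "e B \<le> 2 * log 2 (real (B * L B)) + 1 + real B * (3 + log 2 (real B) + h * ?l)
          + ?l * (real (A B) + real B * r)"
        unfolding e_def h_def r_def using AL B assms(10,12,13)
        by (intro edd_expected_length_le) auto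
      also have "log 2 (real (B * L B)) = log 2 (real B) + log 2 ?l"
        using AL B by (simp add: log_mult)
      \<comment> \<open>Crude estimates by multiples of \<open>?l\<close>, so that the header
        divided by \<open>B * ?l\<close> depends on \<open>B\<close> alone.\<close>
      also have "2 * (log 2 (real B) + log 2 ?l) + 1 \<le> 2 * (log 2 (real B) * ?l + ?l) + ?l"
        using \<open>log 2 ?l \<le> ?l\<close> l B mult_left_mono[OF l, of "log 2 (real B)"] by simp
      finally have "e B \<le> 2 * (log 2 (real B) * ?l + ?l) + ?l
          + real B * (3 + log 2 (real B) + h * ?l) + ?l * (real (A B) + real B * r)"
        by simp
      moreover have "g B = ((2 * log 2 (real B) + 3) / real B + (3 + log 2 (real B)) / ?l
          + real (A B) / real B + r) / h"
        by (simp only: g_def r_def)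
      then have "2 * (log 2 (real B) * ?l + ?l) + ?l + real B * (3 + log 2 (real B) + h * ?l)
          + ?l * (real (A B) + real B * r) = (1 + g B) * (real B * ?l * h)"
        using h l B by (simp add: field_simps)
      ultimately have "e B / (real B * ?l * h) \<le> 1 + g B"
        using h l B by (simp add: divide_le_eq)
      moreover have "0 \<le> g B"
        using h l B unfolding g_def by (intro divide_nonneg_pos add_nonneg_nonneg) auto
      ultimately show ?case by (simp add: \<epsilon>_def)
    qed
    have "(\<lambda>B. (3 + log 2 (real B)) / real (L B)) \<longlonglongrightarrow> 0"
    proof (rule smalloD_tendsto)
      \<comment> \<open>Divergence of \<open>L\<close> alone would not absorb the pointer cost log
        B; its polynomial growth does.\<close>
      have "(\<lambda>B. 3 + log 2 (real B)) \<in> o(\<lambda>B. real B powr k1)"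
        using assms(1) by real_asymp
      then show "(\<lambda>B. 3 + log 2 (real B)) \<in> o(\<lambda>B. real (L B))"
        using landau_o.small.cong_bigtheta[OF assms(9)] by blast
    qed
    moreover have "(\<lambda>B. real (A B) / real B) \<longlonglongrightarrow> 0"
    proof (rule tendsto_sandwich[where f = "\<lambda>_. 0"])
      \<comment> \<open>The majorant is \<open>B powr (- k2)\<close>: first entries near a symbol
        make up a vanishing fraction of the chunks.\<close>
      show "\<forall>\<^sub>F B in at_top. real (A B) / real B \<le> real B powr (1 - k2) / real B"
        using assms(8) by eventually_elim (simp add: divide_right_mono)
      show "(\<lambda>B. real B powr (1 - k2) / real B) \<longlonglongrightarrow> 0"
        using assms(2) by real_asymp
    qed auto
    moreover have "(\<lambda>B. exp (- 2 * real (L B) * (\<beta> - \<delta>)\<^sup>2)) \<longlonglongrightarrow> 0"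
    proof -
      \<comment> \<open>The strict gap between \<delta> and \<beta> makes the decay in
        \<open>L\<close> genuinely exponential.\<close>
      have "0 < (\<beta> - \<delta>)\<^sup>2" using assms(12) by simp
      then have "((\<lambda>x. exp (- 2 * x * (\<beta> - \<delta>)\<^sup>2)) \<longlongrightarrow> 0) at_top"
        by real_asymp
      from filterlim_compose[OF this L] show ?thesis .
    qed
    moreover have "(\<lambda>B. (2 * log 2 (real B) + 3) / real B) \<longlonglongrightarrow> 0" by real_asymp
    ultimately have "g \<longlonglongrightarrow> (0 + 0 + 0 + 0) / h"
      unfolding g_def using h by (intro tendsto_intros) auto
    then show "g \<longlonglongrightarrow> 0" by simp
  qed (auto simp: \<epsilon>_def)
  then have "\<epsilon> \<in> o(\<lambda>_. 1)" by (intro smalloI_tendsto) auto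
  moreover have "1 \<le> e B / s B \<and> e B / s B \<le> h / binary_entropy \<delta> * (1 + \<epsilon> B)"
    if B: "1 \<le> B" for B
  proof
    let ?n = "real B * real (L B)"
    have n: "0 < ?n" using B assms(5)[OF B] by simp
    have s: "?n * binary_entropy \<delta> \<le> s B" using lower[OF B] by (simp add: mult.assoc)
    moreover have nd: "0 < ?n * binary_entropy \<delta>" using n hd by (rule mult_pos_pos)
    ultimately have pos: "0 < s B" by linarith
    then show "1 \<le> e B / s B" using es[OF B] by simp
    \<comment> \<open>Since \<open>e B\<close> is positive, replacing the entropy by its lower bound
      can only enlarge the ratio.\<close>
    have "e B / s B \<le> e B / (?n * binary_entropy \<delta>)"
      using s pos es[OF B] mult_pos_pos[OF pos nd] by (intro divide_left_mono) auto
    also have "\<dots> = h / binary_entropy \<delta> * (e B / (?n * h))"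
      using h by simp
    also have "\<dots> \<le> h / binary_entropy \<delta> * (1 + \<epsilon> B)"
      using h hd by (intro mult_left_mono) (auto simp: \<epsilon>_def)
    finally show "e B / s B \<le> h / binary_entropy \<delta> * (1 + \<epsilon> B)" .
  qed
  ultimately show ?thesis
    by (intro exI[of _ \<epsilon>]) (simp add: e_def s_def h_def Let_def)
qed

end
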